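(* Let $p$ be a prime, $m\in\mathbb{N}$ with $m\ge 1$, $n=p^m$, and $S=\{a\in\mathbb{Z}_n \mid \gcd(a,n)=1\}$. Let $\Gamma=\mathrm{Cay}(\mathbb{Z}_n,S)$ be the Cayley graph on the cyclic group $\mathbb{Z}_n$ with connection set $S$. Then $$\mathrm{Aut}(\Gamma)\cong \mathrm{Sym}(p^{m-1})\ \mathrm{wr}_I\ \mathrm{Sym}(p),\qquad I=\{1,2,\dots,p\}.$$
   Context: For a finite group $G$ and an inverse-closed subset $H\subseteq G$ not containing the identity, $\mathrm{Cay}(G,H)$ is the simple undirected graph with vertex set $G$ in which $x,y$ are adjacent iff $x^{-1}y\in H$. Here $G=\mathbb{Z}_n$ is the additive cyclic group, so $x,y$ are adjacent iff $y-x\in S$. $\mathrm{Aut}(\Gamma)$ is the group of graph automorphisms of $\Gamma$. $\mathrm{Sym}(k)$ is the symmetric group on $k$ points. For a group $A$, $A\ \mathrm{wr}_I\ \mathrm{Sym}(p)$ denotes the wreath product $A^I\rtimes \mathrm{Sym}(p)$, where $\mathrm{Sym}(p)$ acts on $A^I$ by permuting the coordinates indexed by $I$. *)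

theory Defs
  imports
    "HOL-Algebra.Sym_Groups"
    "HOL-Algebra.Product_Groups"
    "HOL-Computational_Algebra.Primes"
    "Graph_Theory.Pair_Digraph"
begin

text \<open>
  Simple undirected graphs are represented by the locale \<^locale>\<open>pair_graph\<close>:
  finite, loop-free digraphs with a symmetric arc relation.
\<close>

definition cayley_graph :: "('a, 'b) monoid_scheme \<Rightarrow> 'a set \<Rightarrow> 'a pair_pre_digraph" where
  "cayley_graph G H =
     \<lparr>pverts = carrier G,
      parcs = {(x, y). x \<in> carrier G \<and> y \<in> carrier G \<and> inv\<^bsub>G\<^esub> x \<otimes>\<^bsub>G\<^esub> y \<in> H}\<rparr>"

definition graph_aut_group :: "'a pair_pre_digraph \<Rightarrow> ('a \<Rightarrow> 'a) monoid" where
  "graph_aut_group \<Gamma> =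
     \<lparr>carrier = {f. f permutes pverts \<Gamma> \<and>
        (\<forall>x\<in>pverts \<Gamma>. \<forall>y\<in>pverts \<Gamma>. (x, y) \<in> parcs \<Gamma> \<longleftrightarrow> (f x, f y) \<in> parcs \<Gamma>)},
      mult = (\<circ>), one = id\<rparr>"

definition semidirect_product ::
    "('a, 'c) monoid_scheme \<Rightarrow> ('b, 'd) monoid_scheme \<Rightarrow> ('b \<Rightarrow> 'a \<Rightarrow> 'a) \<Rightarrow> ('a \<times> 'b) monoid" where
  "semidirect_product N K \<phi> =
     \<lparr>carrier = carrier N \<times> carrier K,
      mult = (\<lambda>(a, s) (b, t). (a \<otimes>\<^bsub>N\<^esub> \<phi> s b, s \<otimes>\<^bsub>K\<^esub> t)),
      one = (\<one>\<^bsub>N\<^esub>, \<one>\<^bsub>K\<^esub>)\<rparr>"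

text \<open>
  The permutation \<open>s\<close> moves the entry at coordinate \<open>i\<close> to coordinate \<open>s i\<close>;
  the inverse makes this a left action.
\<close>

definition permute_coords :: "'i set \<Rightarrow> ('i \<Rightarrow> 'i) \<Rightarrow> ('i \<Rightarrow> 'a) \<Rightarrow> ('i \<Rightarrow> 'a)" where
  "permute_coords I s f = (\<lambda>i\<in>I. f (inv' s i))"

definition wreath_product ::
    "('a, 'c) monoid_scheme \<Rightarrow> 'i set \<Rightarrow> ('i \<Rightarrow> 'i) monoid \<Rightarrow> (('i \<Rightarrow> 'a) \<times> ('i \<Rightarrow> 'i)) monoid" where
  "wreath_product A I K =
     semidirect_product (product_group I (\<lambda>_. A)) K (permute_coords I)"

lemma cayley_graph_pair_graph:
  fixes G (structure)
  assumes "group G" "finite (carrier G)" "H \<subseteq> carrier G" "\<one>\<^bsub>G\<^esub> \<notin> H"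
    and inverse_closed: "\<And>h. h \<in> H \<Longrightarrow> inv\<^bsub>G\<^esub> h \<in> H"
  shows "pair_graph (cayley_graph G H)"
proof -
  interpret group G by fact
  have sub: "parcs (cayley_graph G H) \<subseteq> carrier G \<times> carrier G"
    by (auto simp: cayley_graph_def)
  have "inv y \<otimes> x \<in> H" if "x \<in> carrier G" "y \<in> carrier G" "inv x \<otimes> y \<in> H" for x y
    using inverse_closed[OF that(3)] that by (simp add: inv_mult_group)
  then have "symmetric (with_proj (cayley_graph G H))"
    by (auto simp: symmetric_def arcs_ends_def arc_to_ends_def cayley_graph_def intro!: symI)
  moreover have "finite (parcs (cayley_graph G H))"
    using sub assms(2) by (meson finite_SigmaI finite_subset)
  ultimately show ?thesis
    using assms(2,4) by unfold_locales (auto simp: cayley_graph_def)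
qed

lemma graph_aut_group_group: "group (graph_aut_group \<Gamma>)"
proof (rule groupI)
  fix f assume "f \<in> carrier (graph_aut_group \<Gamma>)"
  then have f: "f permutes pverts \<Gamma>"
    and adj: "\<And>x y. x \<in> pverts \<Gamma> \<Longrightarrow> y \<in> pverts \<Gamma> \<Longrightarrow> (x, y) \<in> parcs \<Gamma> \<longleftrightarrow> (f x, f y) \<in> parcs \<Gamma>"
    by (auto simp: graph_aut_group_def)
  have "(x, y) \<in> parcs \<Gamma> \<longleftrightarrow> (inv' f x, inv' f y) \<in> parcs \<Gamma>"
    if "x \<in> pverts \<Gamma>" "y \<in> pverts \<Gamma>" for x y
    using adj[of "inv' f x" "inv' f y"] that f
    by (simp add: permutes_inverses permutes_in_image[OF permutes_inv[OF f]])
  then have "inv' f \<in> carrier (graph_aut_group \<Gamma>)"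
    using permutes_inv[OF f] by (simp add: graph_aut_group_def)
  moreover have "inv' f \<circ> f = id"
    using f by (rule permutes_inv_o)
  ultimately show "\<exists>g\<in>carrier (graph_aut_group \<Gamma>). g \<otimes>\<^bsub>graph_aut_group \<Gamma>\<^esub> f = \<one>\<^bsub>graph_aut_group \<Gamma>\<^esub>"
    by (auto simp: graph_aut_group_def)
next
  fix f g assume "f \<in> carrier (graph_aut_group \<Gamma>)" "g \<in> carrier (graph_aut_group \<Gamma>)"
  then have f: "f permutes pverts \<Gamma>" and g: "g permutes pverts \<Gamma>"
    and adj_f: "\<And>x y. x \<in> pverts \<Gamma> \<Longrightarrow> y \<in> pverts \<Gamma> \<Longrightarrow> (f x, f y) \<in> parcs \<Gamma> \<longleftrightarrow> (x, y) \<in> parcs \<Gamma>"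
    and adj_g: "\<And>x y. x \<in> pverts \<Gamma> \<Longrightarrow> y \<in> pverts \<Gamma> \<Longrightarrow> (g x, g y) \<in> parcs \<Gamma> \<longleftrightarrow> (x, y) \<in> parcs \<Gamma>"
    by (auto simp: graph_aut_group_def)
  show "f \<otimes>\<^bsub>graph_aut_group \<Gamma>\<^esub> g \<in> carrier (graph_aut_group \<Gamma>)"
    using permutes_compose[OF g f]
    by (simp add: graph_aut_group_def adj_f adj_g permutes_in_image[OF g])
qed (simp_all add: graph_aut_group_def comp_assoc)

lemma semidirect_product_group:
  assumes "group N" "group K"
    and hom: "\<And>s. s \<in> carrier K \<Longrightarrow> \<phi> s \<in> hom N N"
    and act: "\<And>s t a. s \<in> carrier K \<Longrightarrow> t \<in> carrier K \<Longrightarrow> a \<in> carrier N \<Longrightarrow>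
                \<phi> (s \<otimes>\<^bsub>K\<^esub> t) a = \<phi> s (\<phi> t a)"
    and one: "\<And>a. a \<in> carrier N \<Longrightarrow> \<phi> \<one>\<^bsub>K\<^esub> a = a"
  shows "group (semidirect_product N K \<phi>)"
proof -
  interpret N: group N by fact
  interpret K: group K by fact
  have closed: "\<phi> s a \<in> carrier N" if "s \<in> carrier K" "a \<in> carrier N" for s a
    using hom that by (auto simp: hom_def)
  have mult: "\<phi> s (a \<otimes>\<^bsub>N\<^esub> b) = \<phi> s a \<otimes>\<^bsub>N\<^esub> \<phi> s b"
    if "s \<in> carrier K" "a \<in> carrier N" "b \<in> carrier N" for s a b
    using hom that by (auto simp: hom_def)
  show ?thesis
  proof (rule groupI)
    fix x assume "x \<in> carrier (semidirect_product N K \<phi>)"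
    then obtain a s where x: "x = (a, s)" "a \<in> carrier N" "s \<in> carrier K"
      by (auto simp: semidirect_product_def)
    let ?y = "(inv\<^bsub>N\<^esub> (\<phi> (inv\<^bsub>K\<^esub> s) a), inv\<^bsub>K\<^esub> s)"
    have "?y \<in> carrier (semidirect_product N K \<phi>)"
      using x by (simp add: semidirect_product_def closed)
    moreover have "?y \<otimes>\<^bsub>semidirect_product N K \<phi>\<^esub> x = \<one>\<^bsub>semidirect_product N K \<phi>\<^esub>"
      using x by (simp add: semidirect_product_def closed)
    ultimately show "\<exists>y\<in>carrier (semidirect_product N K \<phi>).
        y \<otimes>\<^bsub>semidirect_product N K \<phi>\<^esub> x = \<one>\<^bsub>semidirect_product N K \<phi>\<^esub>"
      by blast
  qed (auto simp: semidirect_product_def closed mult act one N.m_assoc K.m_assoc)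
qed

lemma wreath_product_sym_group:
  assumes "group A"
  shows "group (wreath_product A {1..k} (sym_group k))"
  unfolding wreath_product_def
proof (rule semidirect_product_group)
  interpret A: group A by fact
  show "group (product_group {1..k} (\<lambda>_. A))"
    using assms by simp
  show "group (sym_group k)"
    by (rule sym_group_is_group)
  fix s assume "s \<in> carrier (sym_group k)"
  then have s: "s permutes {1..k}"
    by (simp add: sym_group_carrier)
  have s': "inv' s i \<in> {1..k} \<longleftrightarrow> i \<in> {1..k}" for i
    using permutes_in_image[OF permutes_inv[OF s]] .
  show "permute_coords {1..k} s \<in> hom (product_group {1..k} (\<lambda>_. A)) (product_group {1..k} (\<lambda>_. A))"
    using s' by (auto simp: hom_def permute_coords_def fun_eq_iff restrict_def PiE_iff)
  fix t f assume "t \<in> carrier (sym_group k)"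
  then have t: "t permutes {1..k}"
    by (simp add: sym_group_carrier)
  show "permute_coords {1..k} (s \<otimes>\<^bsub>sym_group k\<^esub> t) f =
      permute_coords {1..k} s (permute_coords {1..k} t f)"
    using s' o_inv_distrib[OF permutes_bij[OF s] permutes_bij[OF t]]
    by (auto simp: permute_coords_def sym_group_mult fun_eq_iff restrict_def)
next
  fix f assume "f \<in> carrier (product_group {1..k} (\<lambda>_. A))"
  then show "permute_coords {1..k} \<one>\<^bsub>sym_group k\<^esub> f = f"
    by (auto simp: permute_coords_def sym_group_one PiE_iff extensional_def fun_eq_iff)
qed

end

theory Submission
  imports Defs
begin

text \<open>
  Units modulo a power of \<open>p\<close> are the residues prime to \<open>p\<close>, so two vertices are adjacent iff they
  differ modulo \<open>p\<close>: the graph is complete multipartite with \<open>p\<close> parts of size \<open>p ^ (m - 1)\<close>.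
  Being equal or non-adjacent is an equivalence relation whose classes are the parts, so every
  automorphism permutes the parts and maps each of them bijectively onto its image. Conversely
  any such choice of bijections is an automorphism.
\<close>

section \<open>The imprimitive action of a wreath product\<close>

text \<open>The map \<open>e\<close> labels points by block and position. The block permutation
  \<open>s\<close> acts first and \<open>a\<close> is then read at the target block
  \<open>s i\<close>; this is the convention under which composition agrees with
  \<open>permute_coords\<close>. Points without a label are fixed, as \<open>permutes\<close>
  demands.\<close>

definition imprimitive_action ::
    "('i \<times> 'j \<Rightarrow> 'v) \<Rightarrow> 'i set \<Rightarrow> 'j set \<Rightarrow> ('i \<Rightarrow> 'j \<Rightarrow> 'j) \<times> ('i \<Rightarrow> 'i) \<Rightarrow> 'v \<Rightarrow> 'v" where
  "imprimitive_action e I J = (\<lambda>(a, s) x.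
     if x \<in> e ` (I \<times> J)
     then (case inv_into (I \<times> J) e x of (i, j) \<Rightarrow> e (s i, a (s i) j))
     else x)"

lemma imprimitive_action_apply:
  assumes "inj_on e (I \<times> J)" "i \<in> I" "j \<in> J"
  shows "imprimitive_action e I J (a, s) (e (i, j)) = e (s i, a (s i) j)"
  using assms by (simp add: imprimitive_action_def)

lemma imprimitive_action_outside:
  "x \<notin> e ` (I \<times> J) \<Longrightarrow> imprimitive_action e I J w x = x"
  by (cases w) (auto simp: imprimitive_action_def)

text \<open>The image label determines \<open>i\<close> because \<open>s\<close> is injective, and
  then \<open>j\<close> because \<open>a (s i)\<close> is. An injective self-map of a finite set is
  onto.\<close>

lemma imprimitive_action_permutes:
  assumes "finite I" "finite J" "inj_on e (I \<times> J)"
    and s: "s permutes I" and a: "\<And>i. i \<in> I \<Longrightarrow> a i permutes J"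
  shows "imprimitive_action e I J (a, s) permutes e ` (I \<times> J)"
proof (rule bij_imp_permutes)
  let ?f = "imprimitive_action e I J (a, s)"
  have si: "s i \<in> I" if "i \<in> I" for i
    using s that by (simp add: permutes_in_image)
  have aj: "a (s i) j \<in> J" if "i \<in> I" "j \<in> J" for i j
    using a[OF si] that by (simp add: permutes_in_image)
  have "inj_on ?f (e ` (I \<times> J))"
  proof (rule inj_onI)
    fix x y assume "x \<in> e ` (I \<times> J)" "y \<in> e ` (I \<times> J)" and eq: "?f x = ?f y"
    then obtain i j i' j' where x: "x = e (i, j)" "i \<in> I" "j \<in> J"
      and y: "y = e (i', j')" "i' \<in> I" "j' \<in> J" by auto
    have "e (s i, a (s i) j) = e (s i', a (s i') j')"
      using eq x y assms(3) by (simp add: imprimitive_action_apply)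
    then have "s i = s i'" "a (s i) j = a (s i') j'"
      using inj_onD[OF assms(3)] x y si aj by auto
    then have "i = i'" "j = j'"
      using permutes_inj[OF s] permutes_inj[OF a[OF si[OF x(2)]]] by (simp_all add: inj_eq)
    then show "x = y" using x y by simp
  qed
  moreover have "?f ` e ` (I \<times> J) \<subseteq> e ` (I \<times> J)"
    using assms(3) si aj by (auto simp: imprimitive_action_apply)
  ultimately show "bij_betw ?f (e ` (I \<times> J)) (e ` (I \<times> J))"
    using assms(1,2) by (simp add: bij_betw_def endo_inj_surj)
qed (simp add: imprimitive_action_outside)

lemma wreath_product_sym_carrier:
  "(a, s) \<in> carrier (wreath_product (sym_group q) {1..k} (sym_group k)) \<longleftrightarrow>
     a \<in> extensional {1..k} \<and> (\<forall>i\<in>{1..k}. a i permutes {1..q}) \<and> s permutes {1..k}"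
  by (auto simp: wreath_product_def semidirect_product_def sym_group_carrier PiE_iff)

lemma wreath_product_sym_mult:
  "(a, s) \<otimes>\<^bsub>wreath_product (sym_group q) {1..k} (sym_group k)\<^esub> (b, t) =
     ((\<lambda>i\<in>{1..k}. a i \<circ> b (inv' s i)), s \<circ> t)"
  by (auto simp: wreath_product_def semidirect_product_def permute_coords_def sym_group_mult
      fun_eq_iff)

section \<open>Automorphisms of complete multipartite graphs\<close>

text \<open>This is the surjectivity of the action. Since \<open>f\<close> preserves non-adjacency,
  the block of \<open>f (e (i, j))\<close> depends on \<open>i\<close> alone, which yields
  \<open>s\<close>; the positions of the images yield \<open>a\<close>.\<close>

lemma complete_multipartite_aut_decomposition:
  fixes e :: "'i \<times> 'j \<Rightarrow> 'v"
  assumes fin: "finite I" "finite J" and "J \<noteq> {}"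
    and inj: "inj_on e (I \<times> J)" and verts: "pverts \<Gamma> = e ` (I \<times> J)"
    and arcs: "\<And>i j i' j'. i \<in> I \<Longrightarrow> j \<in> J \<Longrightarrow> i' \<in> I \<Longrightarrow> j' \<in> J \<Longrightarrow>
                 (e (i, j), e (i', j')) \<in> parcs \<Gamma> \<longleftrightarrow> i \<noteq> i'"
    and f: "f \<in> carrier (graph_aut_group \<Gamma>)"
  obtains a s where "a \<in> extensional I" "\<And>i. i \<in> I \<Longrightarrow> a i permutes J" "s permutes I"
    "imprimitive_action e I J (a, s) = f"
proof -
  have fp: "f permutes e ` (I \<times> J)"
    and adj: "\<And>x y. x \<in> e ` (I \<times> J) \<Longrightarrow> y \<in> e ` (I \<times> J) \<Longrightarrow>
                (x, y) \<in> parcs \<Gamma> \<longleftrightarrow> (f x, f y) \<in> parcs \<Gamma>"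
    using f verts by (auto simp: graph_aut_group_def)
  define blk pos where "blk x = fst (inv_into (I \<times> J) e x)" and "pos x = snd (inv_into (I \<times> J) e x)"
    for x
  have coords: "blk x \<in> I" "pos x \<in> J" "e (blk x, pos x) = x" if "x \<in> e ` (I \<times> J)" for x
    using inv_into_into[OF that] f_inv_into_f[OF that] by (auto simp: blk_def pos_def mem_Times_iff)
  have fe: "f (e (i, j)) \<in> e ` (I \<times> J)" if "i \<in> I" "j \<in> J" for i j
    using that permutes_in_image[OF fp] by auto
  \<comment> \<open>Both sides say that the two points are non-adjacent: the right one before
    \<open>f\<close> is applied, the left one after.\<close>
  have blk_f: "blk (f (e (i, j))) = blk (f (e (i', j'))) \<longleftrightarrow> i = i'"
    if "i \<in> I" "j \<in> J" "i' \<in> I" "j' \<in> J" for i j i' j'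
    using adj[of "e (i, j)" "e (i', j')"] arcs[OF that] that coords[OF fe[OF that(1,2)]]
      coords[OF fe[OF that(3,4)]] arcs[of "blk (f (e (i, j)))" "pos (f (e (i, j)))"
        "blk (f (e (i', j')))" "pos (f (e (i', j')))"]
    by auto
  \<comment> \<open>A reference position in each block; by \<open>blk_f\<close> the value of
    \<open>s\<close> does not depend on its choice.\<close>
  obtain j0 where j0: "j0 \<in> J" using \<open>J \<noteq> {}\<close> by blast
  define s where "s i = (if i \<in> I then blk (f (e (i, j0))) else i)" for i
  have s_in: "s i \<in> I" if "i \<in> I" for i
    using that j0 coords fe by (simp add: s_def)
  have "inj_on s I"
    using blk_f j0 by (auto simp: s_def intro!: inj_onI)
  then have "bij_betw s I I"
    using fin s_in by (simp add: bij_betw_def endo_inj_surj image_subsetI)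
  then have sp: "s permutes I"
    by (rule bij_imp_permutes) (simp add: s_def)
  \<comment> \<open>As \<open>a\<close> is indexed by target blocks, its entry at \<open>i\<close>
    describes \<open>f\<close> on the source block \<open>inv' s i\<close>.\<close>
  define a where "a = (\<lambda>i\<in>I. \<lambda>j. if j \<in> J then pos (f (e (inv' s i, j))) else j)"
  have f_eq: "f (e (i, j)) = e (s i, a (s i) j)" if "i \<in> I" "j \<in> J" for i j
    using that coords(3)[OF fe[OF that]] blk_f[OF that that(1) j0] s_in
    by (simp add: a_def s_def[of i] permutes_inverses[OF sp]) (metis permutes_inverses(2)[OF sp] s_def)
  have a_perm: "a i permutes J" if i: "i \<in> I" for i
  proof (rule bij_imp_permutes)
    define i' where "i' = inv' s i"
    have i': "i' \<in> I" "s i' = i"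
      using i permutes_in_image[OF permutes_inv[OF sp]] permutes_inverses[OF sp]
      by (auto simp: i'_def)
    \<comment> \<open>Both images lie in block \<open>i\<close>, so equal positions force equal
      images under the injective \<open>f\<close>.\<close>
    have "inj_on (a i) J"
    proof (rule inj_onI)
      fix j j' assume j: "j \<in> J" "j' \<in> J" "a i j = a i j'"
      then have "f (e (i', j)) = f (e (i', j'))"
        using f_eq i' by simp
      then have "e (i', j) = e (i', j')"
        using permutes_inj[OF fp] by (simp only: inj_eq)
      then show "j = j'"
        using inj_onD[OF inj] i' j by blast
    qed
    moreover have "a i ` J \<subseteq> J"
      using i i' coords fe by (auto simp: a_def i'_def)
    ultimately show "bij_betw (a i) J J"
      using fin by (simp add: bij_betw_def endo_inj_surj)
  qed (use i in \<open>simp add: a_def\<close>)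
  have "imprimitive_action e I J (a, s) x = f x" for x
  proof (cases "x \<in> e ` (I \<times> J)")
    case True
    then show ?thesis
      using f_eq by (auto simp: imprimitive_action_apply[OF inj])
  next
    case False
    then show ?thesis
      using permutes_not_in[OF fp] by (simp add: imprimitive_action_outside)
  qed
  then show thesis
    using that[of a s] a_perm sp by (auto simp: a_def)
qed

text \<open>The isomorphism is \<open>imprimitive_action\<close>, directed from the wreath product
  to the automorphism group and inverted at the end.\<close>

theorem complete_multipartite_aut_iso:
  fixes e :: "nat \<times> nat \<Rightarrow> 'v" and k q :: nat
  assumes q: "q \<ge> 1"
    and inj: "inj_on e ({1..k} \<times> {1..q})" and verts: "pverts \<Gamma> = e ` ({1..k} \<times> {1..q})"
    and arcs: "\<And>i j i' j'. i \<in> {1..k} \<Longrightarrow> j \<in> {1..q} \<Longrightarrow> i' \<in> {1..k} \<Longrightarrow> j' \<in> {1..q} \<Longrightarrow>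
                 (e (i, j), e (i', j')) \<in> parcs \<Gamma> \<longleftrightarrow> i \<noteq> i'"
  shows "graph_aut_group \<Gamma> \<cong> wreath_product (sym_group q) {1..k} (sym_group k)"
proof -
  let ?I = "{1..k}" and ?J = "{1..q}"
  let ?W = "wreath_product (sym_group q) ?I (sym_group k)"
  let ?\<phi> = "imprimitive_action e ?I ?J"
  \<comment> \<open>Keeps \<open>{1..k}\<close> and \<open>{1..q}\<close> intact under
    simplification, so that membership facts still match the rules about them.\<close>
  note One_nat_def [simp del] atLeastAtMost_iff [simp del]
  note apply_e = imprimitive_action_apply[OF inj]
  have W_group: "group ?W"
    by (intro wreath_product_sym_group sym_group_is_group)
  have in_I: "s i \<in> ?I" if "s permutes ?I" "i \<in> ?I" for s i
    using permutes_in_image[OF that(1)] that(2) by blast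
  have in_J: "a (s i) j \<in> ?J"
    if "(a, s) \<in> carrier ?W" "i \<in> ?I" "j \<in> ?J" for a s i j
    using that in_I[of s i] permutes_in_image[of "a (s i)" ?J j]
    by (auto simp: wreath_product_sym_carrier)
  have closed: "?\<phi> w \<in> carrier (graph_aut_group \<Gamma>)" if "w \<in> carrier ?W" for w
  proof -
    obtain a s where w: "w = (a, s)" by (cases w)
    have as: "\<forall>i\<in>?I. a i permutes ?J" "s permutes ?I"
      using that w by (auto simp: wreath_product_sym_carrier)
    have perm: "?\<phi> (a, s) permutes pverts \<Gamma>"
      unfolding verts using as by (intro imprimitive_action_permutes inj) simp_all
    have "(e (i, j), e (i', j')) \<in> parcs \<Gamma> \<longleftrightarrow>
        (?\<phi> (a, s) (e (i, j)), ?\<phi> (a, s) (e (i', j'))) \<in> parcs \<Gamma>"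
      if ij: "i \<in> ?I" "j \<in> ?J" "i' \<in> ?I" "j' \<in> ?J" for i j i' j'
    proof -
      \<comment> \<open>Adjacency of the images compares only blocks, and \<open>s\<close> is
        injective, so \<open>a\<close> has no influence on it.\<close>
      have "(e (s i, a (s i) j), e (s i', a (s i') j')) \<in> parcs \<Gamma> \<longleftrightarrow> s i \<noteq> s i'"
        using in_J[OF \<open>w \<in> carrier ?W\<close>[unfolded w]] in_I[OF as(2)] ij by (simp add: arcs)
      then show ?thesis
        using arcs[OF ij] injD[OF permutes_inj[OF as(2)], of i i']
        by (auto simp: apply_e[OF ij(1,2)] apply_e[OF ij(3,4)])
    qed
    then have "\<forall>x\<in>pverts \<Gamma>. \<forall>y\<in>pverts \<Gamma>.
        (x, y) \<in> parcs \<Gamma> \<longleftrightarrow> (?\<phi> (a, s) x, ?\<phi> (a, s) y) \<in> parcs \<Gamma>"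
      unfolding verts by blast
    then show ?thesis
      using perm w by (simp add: graph_aut_group_def)
  qed
  have mult: "?\<phi> (w \<otimes>\<^bsub>?W\<^esub> v) = ?\<phi> w \<circ> ?\<phi> v"
    if "w \<in> carrier ?W" "v \<in> carrier ?W" for w v
  proof
    fix x
    obtain a s b t where w: "w = (a, s)" and v: "v = (b, t)" by (cases w, cases v)
    have s: "s permutes ?I" and t: "t permutes ?I"
      using that w v by (auto simp: wreath_product_sym_carrier)
    show "?\<phi> (w \<otimes>\<^bsub>?W\<^esub> v) x = (?\<phi> w \<circ> ?\<phi> v) x"
    proof (cases "x \<in> e ` (?I \<times> ?J)")
      case True
      then obtain i j where x: "x = e (i, j)" and ij: "i \<in> ?I" "j \<in> ?J" by blast
      have ti: "t i \<in> ?I" and bj: "b (t i) j \<in> ?J" and sti: "s (t i) \<in> ?I"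
        using in_I[OF t] in_I[OF s] in_J[OF that(2)[unfolded v]] ij by blast+
      \<comment> \<open>The first component of the product at \<open>s (t i)\<close> is
        \<open>a (s (t i))\<close> composed with \<open>b (inv' s (s (t i)))\<close>, and the
        inverse cancels to leave \<open>b (t i)\<close>.\<close>
      have "?\<phi> (w \<otimes>\<^bsub>?W\<^esub> v) x = e (s (t i), a (s (t i)) (b (t i) j))"
        using sti permutes_inverses(2)[OF s]
        by (simp add: w v x wreath_product_sym_mult apply_e[OF ij])
      then show ?thesis
        by (simp add: w v x apply_e[OF ij] apply_e[OF ti bj])
    qed (simp add: imprimitive_action_outside)
  qed
  have inj_\<phi>: "inj_on ?\<phi> (carrier ?W)"
  proof (rule inj_onI)
    fix w v assume wv: "w \<in> carrier ?W" "v \<in> carrier ?W" and eq: "?\<phi> w = ?\<phi> v"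
    obtain a s b t where w: "w = (a, s)" and v: "v = (b, t)" by (cases w, cases v)
    have s: "s permutes ?I" and t: "t permutes ?I"
      and a: "a \<in> extensional ?I" "\<forall>i\<in>?I. a i permutes ?J"
      and b: "b \<in> extensional ?I" "\<forall>i\<in>?I. b i permutes ?J"
      using wv w v by (auto simp: wreath_product_sym_carrier)
    have ij_eq: "s i = t i \<and> a (s i) j = b (t i) j" if ij: "i \<in> ?I" "j \<in> ?J" for i j
    proof -
      have "e (s i, a (s i) j) = e (t i, b (t i) j)"
        using fun_cong[OF eq, of "e (i, j)"] by (simp only: w v apply_e[OF ij])
      moreover have "(s i, a (s i) j) \<in> ?I \<times> ?J" "(t i, b (t i) j) \<in> ?I \<times> ?J"
        using in_I[OF s] in_I[OF t] in_J[OF wv(1)[unfolded w]] in_J[OF wv(2)[unfolded v]] ij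
        by blast+
      ultimately show ?thesis
        using inj_onD[OF inj] by blast
    qed
    \<comment> \<open>Blocks are nonempty, so position 1 serves as a witness inside each of them;
      off \<open>{1..k}\<close> both permutations are the identity.\<close>
    have st: "s = t"
    proof
      fix i show "s i = t i"
        using ij_eq[of i 1] q permutes_not_in[OF s, of i] permutes_not_in[OF t, of i]
        by (cases "i \<in> ?I") (auto simp: atLeastAtMost_iff)
    qed
    have "a i j = b i j" if i: "i \<in> ?I" for i j
    proof (cases "j \<in> ?J")
      case True
      \<comment> \<open>The block that is sent to \<open>i\<close> is the one on which the action
        reveals \<open>a i\<close>.\<close>
      have "inv' s i \<in> ?I"
        using in_I[OF permutes_inv[OF s] i] .
      from ij_eq[OF this True] show ?thesis
        using st permutes_inverses(1)[OF s] by simp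
    next
      case False
      then show ?thesis
        using a(2) b(2) i permutes_not_in by metis
    qed
    then have "a = b"
      using a(1) b(1) by (intro extensionalityI[of a ?I b]) auto
    then show "w = v" using st w v by simp
  qed
  have surj: "f \<in> ?\<phi> ` carrier ?W" if f: "f \<in> carrier (graph_aut_group \<Gamma>)" for f
  proof -
    obtain a s where "a \<in> extensional ?I" "\<And>i. i \<in> ?I \<Longrightarrow> a i permutes ?J" "s permutes ?I"
      "?\<phi> (a, s) = f"
      by (rule complete_multipartite_aut_decomposition[OF _ _ _ inj verts arcs f]) (use q in auto)
    then show ?thesis
      by (intro image_eqI[of _ _ "(a, s)"]) (auto simp: wreath_product_sym_carrier)
  qed
  have aut_mult: "f \<otimes>\<^bsub>graph_aut_group \<Gamma>\<^esub> g = f \<circ> g" for f g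
    by (simp add: graph_aut_group_def)
  have "?\<phi> \<in> iso ?W (graph_aut_group \<Gamma>)"
    unfolding iso_def hom_def bij_betw_def
    using closed mult inj_\<phi> surj by (auto simp: aut_mult)
  then show ?thesis
    using group.iso_sym[OF W_group] by (auto simp: is_iso_def)
qed

section \<open>Arithmetic of the Cayley graph of units\<close>

text \<open>Reducing modulo \<open>p ^ m\<close> preserves coprimality to \<open>p ^ m\<close>,
  which for positive \<open>m\<close> is coprimality to \<open>p\<close>, that is, non-divisibility
  by the prime \<open>p\<close>.\<close>

lemma coprime_diff_prime_power_iff:
  fixes x y :: int
  assumes "prime p" "m \<ge> 1"
  shows "coprime ((y - x) mod int (p ^ m)) (int (p ^ m)) \<longleftrightarrow> x mod int p \<noteq> y mod int p"
proof -
  have "coprime ((y - x) mod int (p ^ m)) (int (p ^ m)) \<longleftrightarrow> coprime (y - x) (int p)"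
    using assms prime_gt_0_nat[of p] by (simp add: coprime_mod_left_iff del: of_nat_power) simp
  also have "\<dots> \<longleftrightarrow> \<not> int p dvd y - x"
    using assms(1) by (metis coprime_commute prime_imp_coprime prime_nat_int_transfer
        coprime_absorb_left not_prime_unit)
  also have "\<dots> \<longleftrightarrow> x mod int p \<noteq> y mod int p"
    by (metis mod_eq_dvd_iff)
  finally show ?thesis .
qed

theorem theorem3p1:
  fixes p m n :: nat and S :: "int set" and \<Gamma> :: "int pair_pre_digraph"
  assumes "prime p" and "m \<ge> 1" and "n = p ^ m"
    and "S = {a \<in> carrier (integer_mod_group n). gcd a (int n) = 1}"
    and "\<Gamma> = cayley_graph (integer_mod_group n) S"
  shows "graph_aut_group \<Gamma> \<cong> wreath_product (sym_group (p ^ (m - 1))) {1..p} (sym_group p)"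
proof -
  define q where "q = p ^ (m - 1)"
  \<comment> \<open>Division by \<open>p\<close> with remainder: the block is the residue modulo
    \<open>p\<close>, the position is the quotient. Both are shifted by 1 because the symmetric
    groups act on intervals starting at 1.\<close>
  define e :: "nat \<times> nat \<Rightarrow> int" where "e = (\<lambda>(i, j). int ((i - 1) + p * (j - 1)))"
  have p: "p \<ge> 2" and q: "q \<ge> 1" and n: "n = p * q" "n > 0"
    using assms(1-3) prime_ge_2_nat[OF assms(1)] by (auto simp: q_def simp flip: power_Suc)
  have carrier: "carrier (integer_mod_group n) = {0..<int n}"
    using n by (simp add: carrier_integer_mod_group)
  have e_mod: "e (i, j) mod int p = int (i - 1)" and e_div: "e (i, j) div int p = int (j - 1)"
    if "i \<in> {1..p}" for i j
    using that p by (auto simp: e_def simp flip: zmod_int zdiv_int)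
  have inj: "inj_on e ({1..p} \<times> {1..q})"
  proof (rule inj_onI)
    fix u v assume "u \<in> {1..p} \<times> {1..q}" "v \<in> {1..p} \<times> {1..q}" "e u = e v"
    then show "u = v"
      using e_mod[of "fst u" "snd u"] e_mod[of "fst v" "snd v"]
        e_div[of "fst u" "snd u"] e_div[of "fst v" "snd v"]
      by (auto simp: prod_eq_iff)
  qed
  have "e u \<in> {0..<int n}" if "u \<in> {1..p} \<times> {1..q}" for u
  proof -
    obtain i j where u: "u = (i, j)" "i - 1 < p" "j - 1 < q" using \<open>u \<in> _\<close> p q by (cases u) auto
    have "(i - 1) + p * (j - 1) < p * Suc (j - 1)" using u by simp
    also have "\<dots> \<le> p * q" using u by (intro mult_le_mono2) simp
    finally show ?thesis using u n by (simp add: e_def del: of_nat_add of_nat_mult)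
  qed
  \<comment> \<open>\<open>e\<close> is injective into a set of the same finite size, hence onto; no
    preimage has to be constructed.\<close>
  moreover have "card ({1..p} \<times> {1..q}) = card {0..<int n}"
    using n by (simp add: nat_mult_distrib)
  ultimately have img: "e ` ({1..p} \<times> {1..q}) = {0..<int n}"
    using card_image[OF inj] by (intro card_subset_eq) (simp, blast, argo)
  have arcs: "(x, y) \<in> parcs \<Gamma> \<longleftrightarrow> x mod int p \<noteq> y mod int p"
    if "x \<in> {0..<int n}" "y \<in> {0..<int n}" for x y
  proof -
    have diff: "inv\<^bsub>integer_mod_group n\<^esub> x \<otimes>\<^bsub>integer_mod_group n\<^esub> y = (y - x) mod int n"
      using that carrier mod_add_left_eq[of "- x" "int n" y] by simp
    have "(x, y) \<in> parcs \<Gamma> \<longleftrightarrow> (y - x) mod int n \<in> S"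
      using that by (simp add: assms(5) cayley_graph_def carrier diff
          del: mult_integer_mod_group inv_integer_mod_group)
    also have "\<dots> \<longleftrightarrow> coprime ((y - x) mod int n) (int n)"
      using n(2) by (simp add: assms(4) carrier coprime_iff_gcd_eq_1)
    also have "\<dots> \<longleftrightarrow> x mod int p \<noteq> y mod int p"
      unfolding assms(3) by (rule coprime_diff_prime_power_iff[OF assms(1,2)])
    finally show ?thesis .
  qed
  show ?thesis
    unfolding q_def[symmetric]
  proof (rule complete_multipartite_aut_iso[OF q inj])
    show "pverts \<Gamma> = e ` ({1..p} \<times> {1..q})"
      using img carrier assms(5) by (simp add: cayley_graph_def)
    fix i j i' j'
    assume ij: "i \<in> {1..p}" "j \<in> {1..q}" "i' \<in> {1..p}" "j' \<in> {1..q}"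
    then have "e (i, j) \<in> {0..<int n}" "e (i', j') \<in> {0..<int n}"
      using img by blast+
    \<comment> \<open>The residues are \<open>i - 1\<close> and \<open>i' - 1\<close>; as both
      indices are at least 1, the truncated subtraction loses nothing.\<close>
    then show "(e (i, j), e (i', j')) \<in> parcs \<Gamma> \<longleftrightarrow> i \<noteq> i'"
      using ij arcs e_mod by auto
  qed
qed

end
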